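(* (a) Let $k\ge 2$, let $M$ be a matroid on a finite set $V$ and let $N$ be a matroid on $\mathrm{Sym}_k(V)$. If $N$ satisfies the SP-rank Property and Strong Order Multilinearity with respect to $M$, then $N$ satisfies Multilinearity, the Flat Property, the Strong SP-rank Property, and the Closure Property with respect to $M$. (b) For every integer $k\ge 3$ there exist a finite set $V$, a matroid $M$ on $V$ and a matroid $N$ on $\mathrm{Sym}_k(V)$ such that $N$ satisfies the Flat Property and Symmetric Q-power with respect to $M$, but does not satisfy the SP-rank Property with respect to $M$.
   Context: For a finite set $V$ and an integer $k\ge 0$, $\mathrm{Sym}_k(V)$ is the set of unordered $k$-words (multisets of size $k$) over $V$; $\mathrm{Sym}_0(V)=\{\emptyset\}$ (empty word) and $\mathrm{Sym}_1(V)=V$. For $\alpha\in\mathrm{Sym}_i(V)$, $\beta\in\mathrm{Sym}_j(V)$, $\alpha\cdot\beta\in\mathrm{Sym}_{i+j}(V)$ is the concatenation; $A\cdot B=\{\alpha\cdot\beta:\alpha\in A,\beta\in B\}$ and $\alpha\cdot B=\{\alpha\}\cdot B$. For a matroid $M$ on $V$: $r_M$ is the rank function, $\operatorname{rank}M=r_M(V)$, $\mathrm{cl}_M$ is the closure operator, $M^*$ is the dual, $L_M$ is the set of loops, $M|_X$ is the restriction to $X$. Strong order with relabelling: for matroids $M_1=(V_1,r_1)$, $M_2=(V_2,r_2)$ and a bijection $f:V_2\to V_1$, $M_1\preceq_{\rm s}M_2$ via $f$ means $r_1(f(Y))-r_1(f(X))\le r_2(Y)-r_2(X)$ for all $X\subseteq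 Y\subseteq V_2$. Let $N$ be a matroid on $\mathrm{Sym}_k(V)$, $k\ge 1$. Properties of $N$ with respect to $M$: - Symmetric Q-power: for all $1\le i\le k-1$ and all $\alpha_1,\alpha_2\in\mathrm{Sym}_i(V\setminus L_M)$, $N|_{\alpha_1\cdot\mathrm{Sym}_{k-i}(V)}$ is isomorphic to $N|_{\alpha_2\cdot\mathrm{Sym}_{k-i}(V)}$ via $\alpha_1\cdot\beta\mapsto\alpha_2\cdot\beta$; for all $\alpha\in\mathrm{Sym}_{k-1}(V\setminus L_M)$, $N|_{\alpha\cdot V}$ is isomorphic to $M$ via $\alpha\cdot v\mapsto v$; and $\alpha\cdot v$ is a loop of $N$ for all $\alpha\in\mathrm{Sym}_{k-1}(V)$, $v\in L_M$. - SP-rank Property: $\operatorname{rank}N=\binom{\operatorname{rank}M+k-1}{k}$. - Strong SP-rank Property: for all $X\subseteq V$, $r_N(X\cdot\mathrm{Sym}_{k-1}(V))=\binom{\operatorname{rank}M+k-1}{k}-\binom{\operatorname{rank}M-r_M(X)+k-1}{k}$. - Flat Property: for every flat $F$ of $M$, $F\cdot\mathrm{Sym}_{k-1}(V)$ is a flat of $N$. - Closure Property: for all $X\subseteq V$, $\mathrm{cl}_M(X)\cdot\mathrm{Sym}_{k-1}(V)\subseteq\mathrm{cl}_N(X\cdot\mathrm{Sym}_{k-1}(V))$. - Multilinearity: for all $\tau\in\mathrm{Sym}_{k-1}(V\setminus L_M)$, $N|_{\tau\cdot V}$ is isomorphic to $M$ via $\tau\cdot v\mapsto v$; and $\tau\cdot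 v$ is a loop of $N$ for all $\tau\in\mathrm{Sym}_{k-1}(V)$, $v\in L_M$. - Strong Order Multilinearity: for all $\tau\in\mathrm{Sym}_{k-1}(V\setminus L_M)$, $M^*\preceq_{\rm s}(N|_{\tau\cdot V})^*$ via the bijection $\tau\cdot v\mapsto v$; and $\tau\cdot v$ is a loop of $N$ for all $\tau\in\mathrm{Sym}_{k-1}(V)$, $v\in L_M$. *)

theory Defs
  imports Complex_Main "HOL-Library.Multiset"
begin

(* M = (V, r); only the values of r on subsets of V are meaningful. *)
record 'a matroid =
  ground :: "'a set"
  rk :: "'a set \<Rightarrow> nat"

definition is_matroid :: "'a matroid \<Rightarrow> bool" where
  "is_matroid M \<longleftrightarrow>
     finite (ground M) \<and>
     (\<forall>X. X \<subseteq> ground M \<longrightarrow> rk M X \<le> card X) \<and>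
     (\<forall>X Y. X \<subseteq> Y \<and> Y \<subseteq> ground M \<longrightarrow> rk M X \<le> rk M Y) \<and>
     (\<forall>X Y. X \<subseteq> ground M \<and> Y \<subseteq> ground M \<longrightarrow>
        rk M (X \<union> Y) + rk M (X \<inter> Y) \<le> rk M X + rk M Y)"

definition matroid_rank :: "'a matroid \<Rightarrow> nat" where
  "matroid_rank M = rk M (ground M)"

definition closure_in :: "'a matroid \<Rightarrow> 'a set \<Rightarrow> 'a set" where
  "closure_in M X = {v \<in> ground M. rk M (insert v X) = rk M X}"

definition is_flat :: "'a matroid \<Rightarrow> 'a set \<Rightarrow> bool" where
  "is_flat M F \<longleftrightarrow> F \<subseteq> ground M \<and> closure_in M F = F"

definition loops :: "'a matroid \<Rightarrow> 'a set" where
  "loops M = {v \<in> ground M. rk M {v} = 0}"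

(* Intended for X \<subseteq> ground M. *)
definition restriction :: "'a matroid \<Rightarrow> 'a set \<Rightarrow> 'a matroid" where
  "restriction M X = \<lparr>ground = X, rk = rk M\<rparr>"

(* The natural-number subtraction never truncates in a matroid:
   r(V) \<le> r(X) + r(V - X) \<le> card X + r(V - X). *)
definition dual :: "'a matroid \<Rightarrow> 'a matroid" where
  "dual M = \<lparr>ground = ground M,
             rk = (\<lambda>X. card X + rk M (ground M - X) - rk M (ground M))\<rparr>"

definition matroid_iso_via :: "'a matroid \<Rightarrow> 'b matroid \<Rightarrow> ('a \<Rightarrow> 'b) \<Rightarrow> bool" where
  "matroid_iso_via M\<^sub>1 M\<^sub>2 f \<longleftrightarrow>
     bij_betw f (ground M\<^sub>1) (ground M\<^sub>2) \<and>
     (\<forall>X. X \<subseteq> ground M\<^sub>1 \<longrightarrow> rk M\<^sub>2 (f ` X) = rk M\<^sub>1 X)"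

definition strong_order_via :: "'a matroid \<Rightarrow> 'b matroid \<Rightarrow> ('b \<Rightarrow> 'a) \<Rightarrow> bool" where
  "strong_order_via M\<^sub>1 M\<^sub>2 f \<longleftrightarrow>
     bij_betw f (ground M\<^sub>2) (ground M\<^sub>1) \<and>
     (\<forall>X Y. X \<subseteq> Y \<and> Y \<subseteq> ground M\<^sub>2 \<longrightarrow>
        int (rk M\<^sub>1 (f ` Y)) - int (rk M\<^sub>1 (f ` X)) \<le> int (rk M\<^sub>2 Y) - int (rk M\<^sub>2 X))"

abbreviation Sym :: "nat \<Rightarrow> 'a set \<Rightarrow> 'a multiset set" where
  "Sym k V \<equiv> multisets_of_size V k"

(* A letter v is identified with the one-letter word {#v#}, so a set X of letters
   enters a product as Sym 1 X. *)
definition word_prod :: "'a multiset set \<Rightarrow> 'a multiset set \<Rightarrow> 'a multiset set"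
    (infixl "\<cdot>" 70) where
  "A \<cdot> B = {\<alpha> + \<beta> | \<alpha> \<beta>. \<alpha> \<in> A \<and> \<beta> \<in> B}"

(* On \<alpha>\<^sub>1 \<cdot> B this is the map \<alpha>\<^sub>1 \<cdot> \<beta> \<mapsto> \<alpha>\<^sub>2 \<cdot> \<beta>. *)
definition change_prefix :: "'a multiset \<Rightarrow> 'a multiset \<Rightarrow> 'a multiset \<Rightarrow> 'a multiset" where
  "change_prefix \<alpha>\<^sub>1 \<alpha>\<^sub>2 \<omega> = \<alpha>\<^sub>2 + (\<omega> - \<alpha>\<^sub>1)"

(* The map \<alpha> \<cdot> v \<mapsto> v. *)
definition last_letter :: "'a multiset \<Rightarrow> 'a multiset \<Rightarrow> 'a" where
  "last_letter \<alpha> \<omega> = (THE v. \<omega> = \<alpha> + {#v#})"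

definition matroid_on_Sym :: "nat \<Rightarrow> 'a matroid \<Rightarrow> 'a multiset matroid \<Rightarrow> bool" where
  "matroid_on_Sym k M N \<longleftrightarrow>
     is_matroid M \<and> is_matroid N \<and> ground N = Sym k (ground M)"

definition loop_condition :: "nat \<Rightarrow> 'a matroid \<Rightarrow> 'a multiset matroid \<Rightarrow> bool" where
  "loop_condition k M N \<longleftrightarrow>
     (\<forall>\<tau> \<in> Sym (k - 1) (ground M). \<forall>v \<in> loops M. \<tau> + {#v#} \<in> loops N)"

definition multilinearity :: "nat \<Rightarrow> 'a matroid \<Rightarrow> 'a multiset matroid \<Rightarrow> bool" where
  "multilinearity k M N \<longleftrightarrow>
     (\<forall>\<tau> \<in> Sym (k - 1) (ground M - loops M).
        matroid_iso_via (restriction N ({\<tau>} \<cdot> Sym 1 (ground M))) M (last_letter \<tau>)) \<and>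
     loop_condition k M N"

definition symmetric_q_power :: "nat \<Rightarrow> 'a matroid \<Rightarrow> 'a multiset matroid \<Rightarrow> bool" where
  "symmetric_q_power k M N \<longleftrightarrow>
     (\<forall>i. 1 \<le> i \<and> i \<le> k - 1 \<longrightarrow>
        (\<forall>\<alpha>\<^sub>1 \<in> Sym i (ground M - loops M). \<forall>\<alpha>\<^sub>2 \<in> Sym i (ground M - loops M).
           matroid_iso_via
             (restriction N ({\<alpha>\<^sub>1} \<cdot> Sym (k - i) (ground M)))
             (restriction N ({\<alpha>\<^sub>2} \<cdot> Sym (k - i) (ground M)))
             (change_prefix \<alpha>\<^sub>1 \<alpha>\<^sub>2))) \<and>
     (\<forall>\<alpha> \<in> Sym (k - 1) (ground M - loops M).
        matroid_iso_via (restriction N ({\<alpha>} \<cdot> Sym 1 (ground M))) M (last_letter \<alpha>)) \<and>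
     loop_condition k M N"

definition strong_order_multilinearity ::
    "nat \<Rightarrow> 'a matroid \<Rightarrow> 'a multiset matroid \<Rightarrow> bool" where
  "strong_order_multilinearity k M N \<longleftrightarrow>
     (\<forall>\<tau> \<in> Sym (k - 1) (ground M - loops M).
        strong_order_via (dual M) (dual (restriction N ({\<tau>} \<cdot> Sym 1 (ground M))))
          (last_letter \<tau>)) \<and>
     loop_condition k M N"

definition sp_rank_property :: "nat \<Rightarrow> 'a matroid \<Rightarrow> 'a multiset matroid \<Rightarrow> bool" where
  "sp_rank_property k M N \<longleftrightarrow> matroid_rank N = (matroid_rank M + k - 1) choose k"

definition strong_sp_rank_property :: "nat \<Rightarrow> 'a matroid \<Rightarrow> 'a multiset matroid \<Rightarrow> bool" where
  "strong_sp_rank_property k M N \<longleftrightarrow>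
     (\<forall>X. X \<subseteq> ground M \<longrightarrow>
        int (rk N (Sym 1 X \<cdot> Sym (k - 1) (ground M))) =
          int ((matroid_rank M + k - 1) choose k) -
          int ((matroid_rank M - rk M X + k - 1) choose k))"

definition flat_property :: "nat \<Rightarrow> 'a matroid \<Rightarrow> 'a multiset matroid \<Rightarrow> bool" where
  "flat_property k M N \<longleftrightarrow>
     (\<forall>F. is_flat M F \<longrightarrow> is_flat N (Sym 1 F \<cdot> Sym (k - 1) (ground M)))"

definition closure_property :: "nat \<Rightarrow> 'a matroid \<Rightarrow> 'a multiset matroid \<Rightarrow> bool" where
  "closure_property k M N \<longleftrightarrow>
     (\<forall>X. X \<subseteq> ground M \<longrightarrow>
        Sym 1 (closure_in M X) \<cdot> Sym (k - 1) (ground M)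
          \<subseteq> closure_in N (Sym 1 X \<cdot> Sym (k - 1) (ground M)))"

end

theory Submission
  imports Defs
begin

text \<open>(a) Dualising the strong order shows that v in the closure of A implies that \<tau>v lies in the
  closure of \<tau>A for every word \<tau>. Hence the k-words over a basis of M span N, and by the SP-rank
  Property they form a basis of N; this yields the Strong SP-rank and the Closure Property. For
  the other two properties, order the basis and weight letters by their position in the resulting
  flag of flats: as with leading monomials, a loop-free word is not in the closure of the words of
  smaller weight.

  (b) Take M free on four letters and let N have a single circuit, consisting of all k-words with
  support {0,1} or {2,3}. No letter occurs in all words of the circuit, so N is free on words with a
  common letter; and the circuit never has exactly one word avoiding a given set of letters, which
  gives the Flat Property.\<close>

section \<open>Closure and independence\<close>

lemma rk_mono: "is_matroid M \<Longrightarrow> X \<subseteq> Y \<Longrightarrow> Y \<subseteq> ground M \<Longrightarrow> rk M X \<le> rk M Y"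
  by (simp add: is_matroid_def)

lemma rk_le_card: "is_matroid M \<Longrightarrow> X \<subseteq> ground M \<Longrightarrow> rk M X \<le> card X"
  by (simp add: is_matroid_def)

lemma rk_submodular:
  "is_matroid M \<Longrightarrow> X \<subseteq> ground M \<Longrightarrow> Y \<subseteq> ground M \<Longrightarrow>
    rk M (X \<union> Y) + rk M (X \<inter> Y) \<le> rk M X + rk M Y"
  by (simp add: is_matroid_def)

lemma finite_ground: "is_matroid M \<Longrightarrow> finite (ground M)"
  by (simp add: is_matroid_def)

lemma rk_Un_le:
  assumes "is_matroid M" "X \<subseteq> ground M" "Y \<subseteq> ground M"
  shows "rk M (X \<union> Y) \<le> rk M X + rk M Y"
  using rk_submodular[OF assms] by simp

lemma rk_empty: "is_matroid M \<Longrightarrow> rk M {} = 0"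
  using rk_le_card[of M "{}"] by simp

lemma rk_insert_le:
  assumes "is_matroid M" "X \<subseteq> ground M" "v \<in> ground M"
  shows "rk M (insert v X) \<le> rk M X + 1"
  using rk_Un_le[OF assms(1,2), of "{v}"] rk_le_card[OF assms(1), of "{v}"] assms by simp

lemma closure_in_subset: "closure_in M X \<subseteq> ground M"
  by (auto simp: closure_in_def)

lemma subset_closure_in: "X \<subseteq> ground M \<Longrightarrow> X \<subseteq> closure_in M X"
  by (auto simp: closure_in_def insert_absorb)

text \<open>Submodularity for \<open>insert v X\<close> and \<open>Y\<close>: adding
  \<open>v\<close> to the larger set raises the rank by no more than adding it to
  \<open>X\<close>.\<close>

lemma closure_in_mono:
  assumes M: "is_matroid M" and XY: "X \<subseteq> Y" "Y \<subseteq> ground M"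
  shows "closure_in M X \<subseteq> closure_in M Y"
proof
  fix v assume "v \<in> closure_in M X"
  then have v: "v \<in> ground M" "rk M (insert v X) = rk M X"
    by (auto simp: closure_in_def)
  have "rk M (insert v X \<union> Y) + rk M (insert v X \<inter> Y) \<le> rk M (insert v X) + rk M Y"
    using v XY by (intro rk_submodular[OF M]) auto
  moreover have "rk M X \<le> rk M (insert v X \<inter> Y)"
    using v XY by (intro rk_mono[OF M]) auto
  moreover have "insert v X \<union> Y = insert v Y" using XY by auto
  moreover have "rk M Y \<le> rk M (insert v Y)"
    using v XY by (intro rk_mono[OF M]) auto
  ultimately show "v \<in> closure_in M Y"
    using v by (simp add: closure_in_def)
qed

lemma rk_Un_closure_in:
  assumes M: "is_matroid M" and X: "X \<subseteq> ground M" and Y: "Y \<subseteq> closure_in M X"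
  shows "rk M (X \<union> Y) = rk M X"
proof -
  have "finite Y"
    using Y closure_in_subset finite_ground[OF M] by (metis finite_subset)
  then show ?thesis using Y
  proof (induction Y rule: finite_induct)
    case (insert y Y)
    then have "X \<union> Y \<subseteq> ground M" using X closure_in_subset[of M X] by auto
    with insert.prems closure_in_mono[OF M, of X "X \<union> Y"] have "y \<in> closure_in M (X \<union> Y)"
      by auto
    with insert show ?case by (simp add: closure_in_def)
  qed simp
qed

lemma closure_in_closed:
  assumes M: "is_matroid M" and X: "X \<subseteq> ground M" and Y: "Y \<subseteq> closure_in M X"
  shows "closure_in M Y \<subseteq> closure_in M X"
proof
  fix v assume v: "v \<in> closure_in M Y"
  then have vg: "v \<in> ground M" by (simp add: closure_in_def)
  have XY: "X \<union> Y \<subseteq> ground M" using X Y closure_in_subset[of M X] by auto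
  then have "v \<in> closure_in M (X \<union> Y)"
    using v closure_in_mono[OF M, of Y "X \<union> Y"] by auto
  then have "rk M (insert v (X \<union> Y)) = rk M X"
    using rk_Un_closure_in[OF M X Y] by (simp add: closure_in_def)
  moreover have "rk M (insert v X) \<le> rk M (insert v (X \<union> Y))"
    using XY vg by (intro rk_mono[OF M]) auto
  moreover have "rk M X \<le> rk M (insert v X)"
    using X vg by (intro rk_mono[OF M]) auto
  ultimately show "v \<in> closure_in M X" using vg by (simp add: closure_in_def)
qed

lemma rk_eq_if_spanning:
  assumes M: "is_matroid M" and "X \<subseteq> Y" "Y \<subseteq> closure_in M X"
  shows "rk M Y = rk M X"
  using rk_Un_closure_in[OF M _ assms(3)] assms closure_in_subset[of M X]
  by (metis subset_trans sup.absorb2)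

lemma loop_in_closure_in:
  assumes M: "is_matroid M" and "v \<in> loops M" "X \<subseteq> ground M"
  shows "v \<in> closure_in M X"
  using closure_in_mono[OF M, of "{}" X] assms rk_empty[OF M]
  by (auto simp: loops_def closure_in_def)

text \<open>\<open>insert v X\<close> already has rank at least \<open>rk M X + 1\<close>, and
  adding \<open>b\<close> yields a set of the same rank as \<open>insert b X\<close>, so nothing
  more is gained.\<close>

lemma closure_in_exchange:
  assumes M: "is_matroid M" and X: "X \<subseteq> ground M" and b: "b \<in> ground M"
    and v: "v \<in> closure_in M (insert b X)" "v \<notin> closure_in M X"
  shows "b \<in> closure_in M (insert v X)"
proof -
  have vg: "v \<in> ground M" using v by (simp add: closure_in_def)
  have "rk M X \<le> rk M (insert v X)" using X vg by (intro rk_mono[OF M]) auto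
  moreover have "rk M (insert v X) \<noteq> rk M X" using v vg by (simp add: closure_in_def)
  moreover have "rk M (insert v X) \<le> rk M (insert b (insert v X))"
    using X vg b by (intro rk_mono[OF M]) auto
  moreover have "rk M (insert b (insert v X)) = rk M (insert b X)"
    using v by (simp add: closure_in_def insert_commute)
  moreover note rk_insert_le[OF M X b]
  ultimately show ?thesis using b by (simp add: closure_in_def)
qed

section \<open>Independent sets and extension to bases\<close>

definition indep :: "'a matroid \<Rightarrow> 'a set \<Rightarrow> bool" where
  "indep M I \<longleftrightarrow> I \<subseteq> ground M \<and> rk M I = card I"

lemma indep_subset:
  assumes M: "is_matroid M" and "indep M I" "J \<subseteq> I"
  shows "indep M J"
proof -
  have I: "I \<subseteq> ground M" "rk M I = card I" using assms by (auto simp: indep_def)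
  have fin: "finite I" using I finite_ground[OF M] finite_subset by auto
  have "rk M (J \<union> (I - J)) \<le> rk M J + rk M (I - J)"
    using I assms(3) by (intro rk_Un_le[OF M]) auto
  moreover have "rk M (I - J) \<le> card (I - J)" "rk M J \<le> card J"
    using I assms(3) by (auto intro!: rk_le_card[OF M])
  moreover have "J \<union> (I - J) = I" using assms(3) by auto
  moreover have "card I = card J + card (I - J)"
    using assms(3) fin by (metis card_Diff_subset card_mono finite_subset le_add_diff_inverse)
  ultimately show ?thesis using I assms(3) by (simp add: indep_def)
qed

lemma indep_not_in_closure_in:
  assumes M: "is_matroid M" and I: "indep M I" and x: "x \<in> I" "x \<notin> J" and J: "J \<subseteq> I"
  shows "x \<notin> closure_in M J"
proof -
  have "finite J" using I J finite_ground[OF M] by (metis finite_subset indep_def)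
  moreover have "rk M J = card J" "rk M (insert x J) = card (insert x J)"
    using indep_subset[OF M I] J x by (auto simp: indep_def)
  ultimately show ?thesis using x by (simp add: closure_in_def)
qed

lemma indep_insert:
  assumes M: "is_matroid M" and I: "indep M I" and x: "x \<in> ground M" "x \<notin> closure_in M I"
  shows "indep M (insert x I)"
proof -
  have g: "I \<subseteq> ground M" "rk M I = card I" using I by (auto simp: indep_def)
  have fin: "finite I" using g finite_ground[OF M] finite_subset by auto
  have "x \<notin> I" using x subset_closure_in[OF g(1)] by auto
  moreover have "rk M I \<le> rk M (insert x I)" using g x by (intro rk_mono[OF M]) auto
  moreover have "rk M (insert x I) \<noteq> rk M I" using x by (simp add: closure_in_def)
  moreover note rk_insert_le[OF M g(1) x(1)]
  ultimately show ?thesis using g x fin by (simp add: indep_def)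
qed

lemma indep_empty: "is_matroid M \<Longrightarrow> indep M {}"
  by (simp add: indep_def rk_empty)

text \<open>An independent set of maximal size between \<open>I\<close> and \<open>Y\<close> spans
  \<open>Y\<close>, since a missed element could be added. Prescribing \<open>I\<close> allows a
  basis of a subset to be completed to a basis of \<open>M\<close>.\<close>

lemma basis_extension:
  assumes M: "is_matroid M" and I: "indep M I" "I \<subseteq> Y" and Y: "Y \<subseteq> ground M"
  obtains B where "I \<subseteq> B" "B \<subseteq> Y" "indep M B" "Y \<subseteq> closure_in M B"
proof -
  let ?S = "{J. I \<subseteq> J \<and> J \<subseteq> Y \<and> indep M J}"
  have finY: "finite Y" using Y finite_ground[OF M] finite_subset by auto
  then have "finite ?S" by (intro finite_subset[of ?S "Pow Y"]) auto
  moreover have "?S \<noteq> {}" using I by auto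
  ultimately obtain B where B: "B \<in> ?S" and max: "\<And>J. J \<in> ?S \<Longrightarrow> card J \<le> card B"
    using Max_in[of "card ` ?S"] Max_ge[of "card ` ?S"]
    by (smt (verit) finite_imageI image_iff image_is_empty)
  have "Y \<subseteq> closure_in M B"
  proof
    fix y assume y: "y \<in> Y"
    show "y \<in> closure_in M B"
    proof (rule ccontr)
      assume n: "y \<notin> closure_in M B"
      then have "insert y B \<in> ?S" using indep_insert[OF M, of B y] B y Y by auto
      from max[OF this] have "y \<in> B"
        using B finY finite_subset[of B Y] by (auto simp: card_insert_if split: if_splits)
      then show False using n B Y subset_closure_in[of B M] by auto
    qed
  qed
  with B that show ?thesis by auto
qed

section \<open>Words\<close>

lemma mem_Sym: "w \<in> Sym k V \<longleftrightarrow> set_mset w \<subseteq> V \<and> size w = k"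
  by (simp add: multisets_of_size_def)

lemma finite_Sym: "finite V \<Longrightarrow> finite (Sym k V)"
  by (rule finite_multisets_of_size)

lemma Sym_1: "Sym 1 A = (\<lambda>v. {#v#}) ` A"
proof (intro equalityI subsetI)
  fix w assume w: "w \<in> Sym 1 A"
  then obtain v where "w = {#v#}" by (metis mem_Sym size_1_singleton_mset)
  with w show "w \<in> (\<lambda>v. {#v#}) ` A" by (auto simp: mem_Sym)
qed (auto simp: mem_Sym)

lemma singleton_word_prod_letters: "{\<tau>} \<cdot> Sym 1 A = (\<lambda>v. add_mset v \<tau>) ` A"
  unfolding Sym_1 by (auto simp: word_prod_def)

text \<open>Splitting off a letter in \<open>X\<close> works from any position, as words are
  unordered. The product is handled in this form below: words that meet \<open>X\<close>.\<close>

lemma letters_word_prod: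
  assumes "X \<subseteq> V" "k \<ge> 1"
  shows "Sym 1 X \<cdot> Sym (k - 1) V = {w \<in> Sym k V. set_mset w \<inter> X \<noteq> {}}"
proof (intro equalityI subsetI)
  fix w assume "w \<in> Sym 1 X \<cdot> Sym (k - 1) V"
  then obtain x \<sigma> where "w = {#x#} + \<sigma>" "x \<in> X" "\<sigma> \<in> Sym (k - 1) V"
    unfolding Sym_1 by (auto simp: word_prod_def)
  then show "w \<in> {w \<in> Sym k V. set_mset w \<inter> X \<noteq> {}}"
    using assms by (auto simp: mem_Sym)
next
  fix w assume w: "w \<in> {w \<in> Sym k V. set_mset w \<inter> X \<noteq> {}}"
  then obtain x where x: "x \<in># w" "x \<in> X" by auto
  then obtain \<sigma> where "w = add_mset x \<sigma>" by (meson multi_member_split)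
  with w x have "w = {#x#} + \<sigma>" "{#x#} \<in> Sym 1 X" "\<sigma> \<in> Sym (k - 1) V"
    using assms by (auto simp: mem_Sym)
  then show "w \<in> Sym 1 X \<cdot> Sym (k - 1) V" unfolding word_prod_def by blast
qed

lemma last_letter_add_mset [simp]: "last_letter \<tau> (add_mset v \<tau>) = v"
  by (simp add: last_letter_def)

lemma last_letter_image: "last_letter \<tau> ` ((\<lambda>v. add_mset v \<tau>) ` A) = A"
  by (simp add: image_image)

lemma bij_betw_last_letter: "bij_betw (last_letter \<tau>) ((\<lambda>v. add_mset v \<tau>) ` A) A"
  by (auto simp: bij_betw_def inj_on_def image_image)

section \<open>Consequences of the letterwise closure property\<close>

text \<open>Complementation turns dual ranks back into ranks. The cardinalities cancel and the sign
  flips, so rank increments of \<open>N\<close> along \<open>\<tau>\<close> are bounded by those of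
  \<open>M\<close>.\<close>

lemma strong_order_rk_le:
  assumes M: "is_matroid M" and N: "is_matroid N"
    and sub: "(\<lambda>v. add_mset v \<tau>) ` ground M \<subseteq> ground N"
    and so: "strong_order_via (dual M) (dual (restriction N ({\<tau>} \<cdot> Sym 1 (ground M))))
          (last_letter \<tau>)"
    and A: "A \<subseteq> C" "C \<subseteq> ground M"
  shows "int (rk N ((\<lambda>v. add_mset v \<tau>) ` C)) - int (rk N ((\<lambda>v. add_mset v \<tau>) ` A))
          \<le> int (rk M C) - int (rk M A)"
proof -
  let ?p = "\<lambda>v. add_mset v \<tau>" and ?V = "ground M"
  \<comment> \<open>Subadditivity and the cardinality bound show that the natural-number subtraction
    in \<open>dual\<close> is exact, so it may be read over the integers.\<close>
  have dM: "int (rk (dual M) (?V - X)) = int (card (?V - X)) + int (rk M X) - int (rk M ?V)"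
    if X: "X \<subseteq> ?V" for X
  proof -
    have "rk M (X \<union> (?V - X)) \<le> rk M X + rk M (?V - X)" using X by (intro rk_Un_le[OF M]) auto
    moreover have "rk M (?V - X) \<le> card (?V - X)" by (intro rk_le_card[OF M]) auto
    moreover have "X \<union> (?V - X) = ?V" "?V - (?V - X) = X" using X by auto
    ultimately show ?thesis by (simp add: dual_def)
  qed
  have dN: "int (rk (dual (restriction N ({\<tau>} \<cdot> Sym 1 ?V))) (?p ` (?V - X))) =
      int (card (?V - X)) + int (rk N (?p ` X)) - int (rk N (?p ` ?V))"
    if X: "X \<subseteq> ?V" for X
  proof -
    have "rk N (?p ` X \<union> ?p ` (?V - X)) \<le> rk N (?p ` X) + rk N (?p ` (?V - X))"
      using X sub by (intro rk_Un_le[OF N]) auto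
    moreover have "rk N (?p ` (?V - X)) \<le> card (?p ` (?V - X))"
      using sub by (intro rk_le_card[OF N]) auto
    moreover have "card (?p ` (?V - X)) = card (?V - X)" by (simp add: card_image inj_on_def)
    moreover have "?p ` X \<union> ?p ` (?V - X) = ?p ` ?V" "?p ` ?V - ?p ` (?V - X) = ?p ` X"
      using X by auto
    ultimately show ?thesis
      unfolding singleton_word_prod_letters by (simp add: dual_def restriction_def)
  qed
  have "int (rk (dual M) (last_letter \<tau> ` ?p ` (?V - A))) -
        int (rk (dual M) (last_letter \<tau> ` ?p ` (?V - C)))
      \<le> int (rk (dual (restriction N ({\<tau>} \<cdot> Sym 1 ?V))) (?p ` (?V - A))) -
        int (rk (dual (restriction N ({\<tau>} \<cdot> Sym 1 ?V))) (?p ` (?V - C)))"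
  proof (rule so[unfolded strong_order_via_def, THEN conjunct2, rule_format], intro conjI)
    show "?p ` (?V - C) \<subseteq> ?p ` (?V - A)" using A by auto
    show "?p ` (?V - A) \<subseteq> ground (dual (restriction N ({\<tau>} \<cdot> Sym 1 ?V)))"
      unfolding singleton_word_prod_letters by (auto simp: dual_def restriction_def)
  qed
  then show ?thesis
    using A dM[of A] dM[of C] dN[of A] dN[of C] unfolding last_letter_image by auto
qed

text \<open>For loop-free \<open>\<tau>\<close> the rank does not grow in \<open>M\<close> from
  \<open>A\<close> to \<open>insert v A\<close>, hence not in \<open>N\<close>. If
  \<open>\<tau>\<close> contains a loop, that loop can be taken as the last letter and the whole
  word is a loop of \<open>N\<close>.\<close>

lemma strong_order_multilinearity_closure:
  assumes MN: "matroid_on_Sym k M N" and k: "k \<ge> 2" and so: "strong_order_multilinearity k M N"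
    and \<tau>: "\<tau> \<in> Sym (k - 1) (ground M)" and A: "A \<subseteq> ground M" and v: "v \<in> closure_in M A"
  shows "add_mset v \<tau> \<in> closure_in N ((\<lambda>v. add_mset v \<tau>) ` A)"
proof -
  let ?p = "\<lambda>v. add_mset v \<tau>" and ?V = "ground M"
  have M: "is_matroid M" and N: "is_matroid N" and gN: "ground N = Sym k ?V"
    using MN by (auto simp: matroid_on_Sym_def)
  have sub: "?p ` ?V \<subseteq> ground N" using \<tau> k gN by (auto simp: mem_Sym)
  have vV: "v \<in> ?V" using v by (simp add: closure_in_def)
  show ?thesis
  proof (cases "set_mset \<tau> \<subseteq> ?V - loops M")
    case True
    then have "\<tau> \<in> Sym (k - 1) (?V - loops M)" using \<tau> by (simp add: mem_Sym)
    then have "int (rk N (?p ` insert v A)) - int (rk N (?p ` A))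
          \<le> int (rk M (insert v A)) - int (rk M A)"
      using so A vV unfolding strong_order_multilinearity_def
      by (intro strong_order_rk_le[OF M N sub]) auto
    moreover have "rk N (?p ` A) \<le> rk N (?p ` insert v A)"
      using A vV sub by (intro rk_mono[OF N]) auto
    moreover have "add_mset v \<tau> \<in> ground N" using sub vV by auto
    ultimately show ?thesis using v by (simp add: closure_in_def)
  next
    case False
    then obtain l where l: "l \<in># \<tau>" "l \<in> loops M" using \<tau> by (auto simp: mem_Sym)
    then obtain \<sigma> where \<sigma>: "\<tau> = add_mset l \<sigma>" by (meson multi_member_split)
    have "add_mset v \<sigma> \<in> Sym (k - 1) ?V" using \<tau> vV \<sigma> by (auto simp: mem_Sym)
    then have "add_mset v \<sigma> + {#l#} \<in> loops N"
      using so l by (auto simp: strong_order_multilinearity_def loop_condition_def)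
    then have "add_mset v \<tau> \<in> loops N" by (simp add: \<sigma> add_mset_commute)
    then show ?thesis using A sub by (intro loop_in_closure_in[OF N]) auto
  qed
qed

text \<open>The one-sided form of multilinearity: closures in \<open>M\<close> carry over to
  \<open>N\<close> after multiplication by any word. Together with the rank of \<open>N\<close> this
  forces the converse.\<close>

locale sym_power =
  fixes k :: nat and M :: "'a matroid" and N :: "'a multiset matroid"
  assumes k: "k \<ge> 1"
    and matroid_on: "matroid_on_Sym k M N"
    and rank: "sp_rank_property k M N"
    and letter_closure: "\<And>\<tau> A v. \<tau> \<in> Sym (k - 1) (ground M) \<Longrightarrow> A \<subseteq> ground M \<Longrightarrow>
      v \<in> closure_in M A \<Longrightarrow> add_mset v \<tau> \<in> closure_in N ((\<lambda>v. add_mset v \<tau>) ` A)"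
begin

lemma M: "is_matroid M" and N: "is_matroid N" and ground_N: "ground N = Sym k (ground M)"
  using matroid_on by (auto simp: matroid_on_Sym_def)

lemma Sym_add_mset:
  assumes "add_mset v \<tau> \<in> Sym k A"
  shows "v \<in> A" "\<tau> \<in> Sym (k - 1) A"
  using assms by (auto simp: mem_Sym)

lemma add_mset_Sym: "v \<in> A \<Longrightarrow> \<tau> \<in> Sym (k - 1) A \<Longrightarrow> add_mset v \<tau> \<in> Sym k A"
  using k by (auto simp: mem_Sym)

text \<open>If every letter outside B can be expanded into letters of B without leaving S, then
  expanding one letter at a time reaches words over B.\<close>

lemma spanned_by_words_over:
  assumes S: "S \<subseteq> Sym k (ground M)" and B: "B \<subseteq> ground M"
    and expand: "\<And>v \<tau>. add_mset v \<tau> \<in> S \<Longrightarrow> v \<notin> B \<Longrightarrow>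
      \<exists>A. A \<subseteq> B \<and> v \<in> closure_in M A \<and> (\<forall>x\<in>A. add_mset x \<tau> \<in> S)"
  shows "S \<subseteq> closure_in N (S \<inter> Sym k B)"
proof
  fix w assume "w \<in> S"
  then show "w \<in> closure_in N (S \<inter> Sym k B)"
  proof (induction "size (filter_mset (\<lambda>x. x \<notin> B) w)" arbitrary: w rule: less_induct)
    case less
    have g: "S \<inter> Sym k B \<subseteq> ground N" using S ground_N by auto
    show ?case
    proof (cases "set_mset w \<subseteq> B")
      case True
      then have "w \<in> S \<inter> Sym k B" using less.prems S by (auto simp: mem_Sym)
      then show ?thesis using subset_closure_in[OF g] by auto
    next
      case False
      then obtain v \<tau> where w: "w = add_mset v \<tau>" and v: "v \<notin> B"
        by (meson subsetI multi_member_split)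
      obtain A where A: "A \<subseteq> B" "v \<in> closure_in M A" "\<And>x. x \<in> A \<Longrightarrow> add_mset x \<tau> \<in> S"
        using expand[of v \<tau>] less.prems v unfolding w by blast
      have "\<tau> \<in> Sym (k - 1) (ground M)" using less.prems S Sym_add_mset(2)[of v \<tau>] unfolding w by blast
      with A B have "w \<in> closure_in N ((\<lambda>v. add_mset v \<tau>) ` A)"
        using letter_closure w by auto
      \<comment> \<open>Replacing \<open>v\<close> by a letter of \<open>B\<close> leaves one letter
        fewer outside \<open>B\<close>, so the induction hypothesis applies.\<close>
      moreover have "(\<lambda>v. add_mset v \<tau>) ` A \<subseteq> closure_in N (S \<inter> Sym k B)"
        using A v w less.hyps by (force simp: subset_iff)
      ultimately show ?thesis using closure_in_closed[OF N g] by blast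
    qed
  qed
qed

text \<open>Words over \<open>B\<close> span \<open>N\<close>, and their number
  \<open>card B + k - 1\<close> choose \<open>k\<close> equals the rank of \<open>N\<close>; a
  spanning set of that size is independent.\<close>

lemma words_over_basis_indep:
  assumes B: "indep M B" "ground M \<subseteq> closure_in M B"
  shows "indep N (Sym k B)"
proof -
  let ?V = "ground M"
  have BV: "B \<subseteq> ?V" using B by (simp add: indep_def)
  have fB: "finite B" using BV finite_ground[OF M] finite_subset by auto
  have sub: "Sym k B \<subseteq> Sym k ?V" using BV by (rule multisets_of_size_mono)
  have "Sym k ?V \<subseteq> closure_in N (Sym k ?V \<inter> Sym k B)"
  proof (rule spanned_by_words_over[OF order.refl BV])
    fix v \<tau> assume "add_mset v \<tau> \<in> Sym k ?V"
    then show "\<exists>A. A \<subseteq> B \<and> v \<in> closure_in M A \<and> (\<forall>x\<in>A. add_mset x \<tau> \<in> Sym k ?V)"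
      using B BV by (intro exI[of _ B]) (auto simp: mem_Sym)
  qed
  then have "rk N (Sym k ?V) = rk N (Sym k B)"
    using rk_eq_if_spanning[OF N sub] sub by (simp add: Int_absorb1)
  moreover have "rk N (Sym k ?V) = (rk M ?V + k - 1) choose k"
    using rank ground_N by (simp add: sp_rank_property_def matroid_rank_def)
  moreover have "rk M ?V = card B" using rk_eq_if_spanning[OF M BV] B by (simp add: indep_def)
  ultimately show ?thesis
    using sub fB ground_N by (simp add: indep_def card_multisets_of_size)
qed

lemma closure_property: "closure_property k M N"
  unfolding closure_property_def
proof (intro allI impI subsetI)
  fix X w assume X: "X \<subseteq> ground M" and w: "w \<in> Sym 1 (closure_in M X) \<cdot> Sym (k - 1) (ground M)"
  let ?S = "Sym 1 X \<cdot> Sym (k - 1) (ground M)"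
  obtain v \<tau> where v: "w = add_mset v \<tau>" "v \<in> closure_in M X" "\<tau> \<in> Sym (k - 1) (ground M)"
    using w unfolding Sym_1 by (auto simp: word_prod_def)
  have "w \<in> closure_in N ((\<lambda>v. add_mset v \<tau>) ` X)" using letter_closure v X by auto
  moreover have "(\<lambda>v. add_mset v \<tau>) ` X \<subseteq> ?S"
    using v(3) X unfolding letters_word_prod[OF X k] by (auto intro: add_mset_Sym)
  moreover have "?S \<subseteq> ground N" unfolding letters_word_prod[OF X k] ground_N by auto
  ultimately show "w \<in> closure_in N ?S" using closure_in_mono[OF N] by blast
qed

text \<open>With a basis \<open>C\<close> of \<open>X\<close> completed to a basis \<open>B\<close>
  of \<open>M\<close>, the words over \<open>B\<close> that meet \<open>C\<close> form a basis of
  the words that meet \<open>X\<close>.\<close>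

lemma strong_sp_rank_property: "strong_sp_rank_property k M N"
  unfolding strong_sp_rank_property_def
proof (intro allI impI)
  fix X assume X: "X \<subseteq> ground M"
  let ?V = "ground M"
  obtain C where C: "C \<subseteq> X" "indep M C" "X \<subseteq> closure_in M C"
    using basis_extension[OF M indep_empty[OF M] _ X] by auto
  obtain B where B: "C \<subseteq> B" "B \<subseteq> ?V" "indep M B" "?V \<subseteq> closure_in M B"
    using basis_extension[OF M C(2)] C(1) X by (metis subset_refl subset_trans)
  let ?S = "{w \<in> Sym k ?V. set_mset w \<inter> X \<noteq> {}}"
  let ?T = "{w \<in> Sym k B. set_mset w \<inter> C \<noteq> {}}"
  \<comment> \<open>An element of \<open>B\<close> outside \<open>C\<close> is not spanned by
    \<open>C\<close>, so it cannot lie in \<open>X\<close>.\<close>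
  have "x \<in> C" if "x \<in> X" "x \<in> B" for x
    using indep_not_in_closure_in[OF M B(3) that(2) _ B(1)] that C by auto
  then have ST: "?S \<inter> Sym k B = ?T"
    using B(1,2) C(1) unfolding multisets_of_size_def by blast
  have "?S \<subseteq> closure_in N (?S \<inter> Sym k B)"
  proof (rule spanned_by_words_over[OF _ B(2)])
    fix v \<tau> assume w: "add_mset v \<tau> \<in> ?S"
    \<comment> \<open>The expanded words must still meet \<open>X\<close>. A letter in
      \<open>X\<close> is therefore expanded into \<open>C\<close> only; for a letter outside
      \<open>X\<close> the rest of the word already meets \<open>X\<close>.\<close>
    show "\<exists>A. A \<subseteq> B \<and> v \<in> closure_in M A \<and> (\<forall>x\<in>A. add_mset x \<tau> \<in> ?S)"
    proof (cases "v \<in> X")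
      case True
      with w show ?thesis using B C X by (intro exI[of _ C]) (auto simp: mem_Sym)
    next
      case False
      with w show ?thesis using B by (intro exI[of _ B]) (auto simp: mem_Sym)
    qed
  qed auto
  moreover have "?T \<subseteq> ?S" using ST by blast
  ultimately have "rk N ?S = rk N ?T" using rk_eq_if_spanning[OF N, of ?T ?S] ST by simp
  also have "rk N ?T = card ?T"
    using indep_subset[OF N words_over_basis_indep[OF B(3,4)], of ?T] by (auto simp: indep_def)
  \<comment> \<open>Counting the words that avoid \<open>C\<close> produces the subtracted binomial
    coefficient.\<close>
  also have "?T = Sym k B - Sym k (B - C)" by (auto simp: mem_Sym)
  also have "int (card \<dots>) = int (card (Sym k B)) - int (card (Sym k (B - C)))"
  proof -
    have "finite B" using B(2) finite_ground[OF M] finite_subset by auto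
    then have "finite (Sym k B)" by (rule finite_Sym)
    moreover have "Sym k (B - C) \<subseteq> Sym k B" by (rule multisets_of_size_mono) auto
    ultimately show ?thesis
      by (metis card_Diff_subset card_mono finite_subset of_nat_diff)
  qed
  also have "\<dots> = int ((card B + k - 1) choose k) - int ((card (B - C) + k - 1) choose k)"
    using B(2) finite_ground[OF M] finite_subset[of B] by (simp add: card_multisets_of_size)
  also have "card B = matroid_rank M"
    using rk_eq_if_spanning[OF M B(2,4)] B(3) by (simp add: indep_def matroid_rank_def)
  also have "card (B - C) = matroid_rank M - rk M X"
  proof -
    have "finite C" using C(1) X finite_ground[OF M] by (meson finite_subset)
    then have "card (B - C) = card B - card C" using B(1) by (rule card_Diff_subset)
    moreover have "rk M X = card C"
      using rk_eq_if_spanning[OF M C(1,3)] C(2) by (simp add: indep_def)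
    ultimately show ?thesis using \<open>card B = matroid_rank M\<close> by simp
  qed
  finally show "int (rk N (Sym 1 X \<cdot> Sym (k - 1) ?V)) =
    int ((matroid_rank M + k - 1) choose k) - int ((matroid_rank M - rk M X + k - 1) choose k)"
    unfolding letters_word_prod[OF X k] .
qed

end

section \<open>Leading words\<close>

text \<open>The level of a letter is its position in the flag of flats spanned by the initial segments
  of an ordered basis bs. Replacing each letter of a loop-free word by the basis element of
  its level gives its leading word: modulo words of smaller weight, the two are parallel in N.\<close>

locale sym_power_flag = sym_power k M N
  for k :: nat and M :: "'a matroid" and N :: "'a multiset matroid" +
  fixes bs :: "'a list" and g :: "nat \<Rightarrow> nat"
  assumes distinct_bs: "distinct bs"
    and basis: "indep M (set bs)" "ground M \<subseteq> closure_in M (set bs)"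
    and g: "strict_mono g"
begin

text \<open>Level 0 consists of the loops, so the basis element \<open>bs ! i\<close> has level
  \<open>Suc i\<close>.\<close>

definition lev :: "'a \<Rightarrow> nat" where
  "lev v = (LEAST j. v \<in> closure_in M (set (take j bs)))"

text \<open>The function \<open>g\<close> is left open: the identity serves Multilinearity, while
  the Flat Property takes weights that jump above a chosen level.\<close>

definition wt :: "'a multiset \<Rightarrow> nat" where
  "wt w = (\<Sum>v\<in>#w. g (lev v))"

definition lighter :: "nat \<Rightarrow> 'a multiset set" where
  "lighter s = {w \<in> Sym k (ground M). wt w < s}"

lemma wt_add_mset [simp]: "wt (add_mset v \<tau>) = g (lev v) + wt \<tau>"
  by (simp add: wt_def)

lemma bs_subset: "set bs \<subseteq> ground M"
  using basis by (simp add: indep_def)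

lemma take_subset: "set (take j bs) \<subseteq> ground M"
  using bs_subset set_take_subset by fastforce

text \<open>The flats spanned by the initial segments increase, so membership from the least index
  on is permanent.\<close>

lemma lev_le_iff: "v \<in> ground M \<Longrightarrow> lev v \<le> j \<longleftrightarrow> v \<in> closure_in M (set (take j bs))"
proof
  assume v: "v \<in> ground M" and j: "lev v \<le> j"
  have "v \<in> closure_in M (set (take (length bs) bs))" using basis v by auto
  then have "v \<in> closure_in M (set (take (lev v) bs))" unfolding lev_def by (rule LeastI)
  then show "v \<in> closure_in M (set (take j bs))"
    using closure_in_mono[OF M set_take_subset_set_take[OF j] take_subset] by auto
qed (auto simp: lev_def intro: Least_le)

lemma lev_le_length: "v \<in> ground M \<Longrightarrow> lev v \<le> length bs"
  using lev_le_iff basis by auto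

lemma lev_nth:
  assumes i: "i < length bs"
  shows "lev (bs ! i) = Suc i"
proof -
  have b: "bs ! i \<in> set bs" "bs ! i \<in> ground M" using i bs_subset by auto
  have "bs ! i \<in> set (take (Suc i) bs)" using i by (simp add: take_Suc_conv_app_nth)
  then have "lev (bs ! i) \<le> Suc i"
    using lev_le_iff[OF b(2)] subset_closure_in[OF take_subset] by blast
  moreover have "bs ! i \<notin> set (take i bs)"
    using distinct_bs i by (auto simp: in_set_conv_nth nth_eq_iff_index_eq)
  then have "bs ! i \<notin> closure_in M (set (take i bs))"
    using indep_not_in_closure_in[OF M basis(1) b(1) _ set_take_subset] by auto
  then have "\<not> lev (bs ! i) \<le> i" using lev_le_iff[OF b(2)] by simp
  ultimately show ?thesis by simp
qed

lemma lev_take: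
  assumes "x \<in> set (take j bs)"
  shows "lev x \<le> j"
  using assms by (metis lev_le_iff subsetD subset_closure_in take_subset)

lemma nth_nonloop:
  assumes i: "i < length bs"
  shows "bs ! i \<in> ground M - loops M"
proof -
  have b: "bs ! i \<in> ground M" using i bs_subset by auto
  have "bs ! i \<notin> closure_in M (set (take 0 bs))"
    using lev_le_iff[OF b, of 0] lev_nth[OF i] by simp
  then show ?thesis using loop_in_closure_in[OF M, of "bs ! i" "set (take 0 bs)"] b by auto
qed

text \<open>\<open>v\<close> lies in the flat of \<open>take (Suc i) bs\<close> but not in that of
  \<open>take i bs\<close>; exchange then makes \<open>v\<close> and \<open>bs ! i\<close>
  interchangeable modulo earlier basis elements.\<close>

lemma lev_nonloop:
  assumes v: "v \<in> ground M - loops M"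
  obtains i where "i < length bs" "lev v = Suc i" "bs ! i \<in> closure_in M (insert v (set (take i bs)))"
proof -
  have vV: "v \<in> ground M" using v by simp
  have "v \<notin> closure_in M (set (take 0 bs))"
    using v rk_empty[OF M] by (auto simp: closure_in_def loops_def)
  then have "lev v \<noteq> 0" using lev_le_iff[OF vV, of 0] by auto
  then obtain i where i: "lev v = Suc i" using not0_implies_Suc by blast
  then have il: "i < length bs" using lev_le_length[OF vV] by simp
  have "v \<in> closure_in M (insert (bs ! i) (set (take i bs)))"
    using lev_le_iff[OF vV, of "Suc i"] i il by (simp add: take_Suc_conv_app_nth)
  moreover have "v \<notin> closure_in M (set (take i bs))"
    using lev_le_iff[OF vV, of i] i by simp
  moreover have "bs ! i \<in> ground M" using il bs_subset by auto
  ultimately have "bs ! i \<in> closure_in M (insert v (set (take i bs)))"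
    by (rule closure_in_exchange[OF M take_subset, rotated])
  then show ?thesis by (rule that[OF il i])
qed

lemma lighter_subset: "lighter s \<subseteq> ground N"
  by (auto simp: lighter_def ground_N)

text \<open>A letter expands into basis elements of at most its own level, which never increases the
  weight.\<close>

lemma lighter_spanned: "lighter s \<subseteq> closure_in N (lighter s \<inter> Sym k (set bs))"
proof (rule spanned_by_words_over[OF _ bs_subset])
  fix v \<tau> assume w: "add_mset v \<tau> \<in> lighter s"
  then have v: "v \<in> ground M" by (auto simp: lighter_def mem_Sym)
  let ?A = "set (take (lev v) bs)"
  have "add_mset x \<tau> \<in> lighter s" if "x \<in> ?A" for x
  proof -
    have "g (lev x) \<le> g (lev v)" using lev_take[OF that] g by (simp add: strict_mono_less_eq)
    then show ?thesis using w that take_subset by (auto simp: lighter_def mem_Sym)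
  qed
  moreover have "v \<in> closure_in M ?A" using lev_le_iff[OF v] by auto
  ultimately show "\<exists>A. A \<subseteq> set bs \<and> v \<in> closure_in M A \<and> (\<forall>x\<in>A. add_mset x \<tau> \<in> lighter s)"
    by (intro exI[of _ ?A]) (simp add: set_take_subset)
qed (auto simp: lighter_def)

text \<open>A word over the basis is independent of the lighter basis words, which span all lighter
  words. Any other loop-free word is reduced to its leading word, one letter at a time.\<close>

lemma nonloop_word_not_in_closure_lighter:
  assumes "w \<in> Sym k (ground M - loops M)"
  shows "w \<notin> closure_in N (lighter (wt w))"
  using assms
proof (induction "size (filter_mset (\<lambda>x. x \<notin> set bs) w)" arbitrary: w rule: less_induct)
  case less
  let ?D = "lighter (wt w)"
  show ?case
  proof (cases "set_mset w \<subseteq> set bs")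
    case True
    then have "w \<in> Sym k (set bs)" using less.prems by (simp add: mem_Sym)
    moreover have "w \<notin> ?D \<inter> Sym k (set bs)" by (simp add: lighter_def)
    ultimately have "w \<notin> closure_in N (?D \<inter> Sym k (set bs))"
      by (intro indep_not_in_closure_in[OF N words_over_basis_indep[OF basis]]) auto
    moreover have "closure_in N ?D \<subseteq> closure_in N (?D \<inter> Sym k (set bs))"
      using lighter_subset lighter_spanned by (intro closure_in_closed[OF N]) auto
    ultimately show ?thesis by auto
  next
    case False
    then obtain v \<tau> where w: "w = add_mset v \<tau>" and v: "v \<notin> set bs"
      by (meson subsetI multi_member_split)
    have vV: "v \<in> ground M - loops M" and \<tau>: "\<tau> \<in> Sym (k - 1) (ground M - loops M)"
      using less.prems unfolding w by (fact Sym_add_mset)+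
    then have \<tau>V: "\<tau> \<in> Sym (k - 1) (ground M)" by (auto simp: mem_Sym)
    obtain i where i: "i < length bs" "lev v = Suc i"
        "bs ! i \<in> closure_in M (insert v (set (take i bs)))"
      using lev_nonloop[OF vV] .
    let ?w' = "add_mset (bs ! i) \<tau>"
    have w': "?w' \<in> Sym k (ground M - loops M)"
      using nth_nonloop[OF i(1)] \<tau> by (rule add_mset_Sym)
    \<comment> \<open>Equal weights mean that \<open>w\<close> and \<open>?w'\<close> are compared
      with the same set \<open>?D\<close>.\<close>
    have wt': "wt ?w' = wt w" using i lev_nth by (simp add: w)
    have "?w' \<notin> closure_in N ?D"
      using less.hyps[of ?w'] w' wt' v i(1) by (simp add: w)
    moreover have "?w' \<in> closure_in N ?D" if wD: "w \<in> closure_in N ?D"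
    proof -
      have "?w' \<in> closure_in N ((\<lambda>v. add_mset v \<tau>) ` insert v (set (take i bs)))"
        using i(3) vV take_subset by (intro letter_closure[OF \<tau>V]) auto
      \<comment> \<open>Earlier basis elements have strictly smaller level, so all terms of the
        expansion of \<open>?w'\<close> other than \<open>w\<close> are lighter.\<close>
      moreover have "add_mset x \<tau> \<in> ?D" if "x \<in> set (take i bs)" for x
      proof -
        have "g (lev x) < g (lev v)"
          using lev_take[OF that] i(2) g by (simp add: strict_mono_less)
        then show ?thesis
          using that take_subset \<tau>V by (auto simp: w lighter_def intro!: add_mset_Sym)
      qed
      then have "(\<lambda>v. add_mset v \<tau>) ` insert v (set (take i bs)) \<subseteq> closure_in N ?D"
        using wD subset_closure_in[OF lighter_subset] by (auto simp: w)
      ultimately show ?thesis using closure_in_closed[OF N lighter_subset] by blast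
    qed
    ultimately show ?thesis by blast
  qed
qed

text \<open>Along \<open>bs\<close> the words have strictly increasing weight, so none is in the
  closure of its predecessors.\<close>

lemma prefixed_basis_indep:
  assumes \<tau>: "\<tau> \<in> Sym (k - 1) (ground M - loops M)"
  shows "indep N ((\<lambda>v. add_mset v \<tau>) ` set bs)"
proof -
  let ?p = "\<lambda>v. add_mset v \<tau>"
  have \<tau>V: "\<tau> \<in> Sym (k - 1) (ground M)" using \<tau> by (auto simp: mem_Sym)
  have "i \<le> length bs \<Longrightarrow> indep N (?p ` set (take i bs))" for i
  proof (induction i)
    case 0
    then show ?case by (simp add: indep_empty[OF N])
  next
    case (Suc i)
    let ?w = "?p (bs ! i)"
    have i: "i < length bs" using Suc.prems by simp
    then have b: "bs ! i \<in> ground M" using bs_subset by auto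
    have "?w \<notin> closure_in N (lighter (wt ?w))"
      using nth_nonloop[OF i] \<tau> by (intro nonloop_word_not_in_closure_lighter add_mset_Sym)
    moreover have "?p x \<in> lighter (wt ?w)" if x: "x \<in> set (take i bs)" for x
    proof -
      have "g (lev x) < g (lev (bs ! i))"
        using lev_take[OF x] lev_nth[OF i] g by (simp add: strict_mono_less)
      then show ?thesis using x take_subset \<tau>V by (auto simp: lighter_def intro!: add_mset_Sym)
    qed
    then have "?p ` set (take i bs) \<subseteq> lighter (wt ?w)" by auto
    ultimately have "?w \<notin> closure_in N (?p ` set (take i bs))"
      using closure_in_mono[OF N _ lighter_subset] by blast
    moreover have "?w \<in> ground N" using b \<tau>V unfolding ground_N by (rule add_mset_Sym)
    ultimately have "indep N (insert ?w (?p ` set (take i bs)))"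
      using Suc i by (intro indep_insert[OF N]) auto
    then show ?case using i by (simp add: take_Suc_conv_app_nth)
  qed
  from this[of "length bs"] show ?thesis by simp
qed

end

section \<open>Multilinearity and the Flat Property from weights\<close>

context sym_power
begin

text \<open>Letterwise closure bounds ranks after prefixing from above; independence of the prefixed
  basis gives the matching lower bound.\<close>

lemma multilinearity:
  assumes loops: "loop_condition k M N"
  shows "multilinearity k M N"
  unfolding multilinearity_def
proof (intro conjI ballI loops)
  fix \<tau> assume \<tau>: "\<tau> \<in> Sym (k - 1) (ground M - loops M)"
  then have \<tau>V: "\<tau> \<in> Sym (k - 1) (ground M)" by (auto simp: mem_Sym)
  let ?p = "\<lambda>v. add_mset v \<tau>"
  have rk: "rk N (?p ` A) = rk M A" if A: "A \<subseteq> ground M" for A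
  proof -
    obtain C where C: "C \<subseteq> A" "indep M C" "A \<subseteq> closure_in M C"
      using basis_extension[OF M indep_empty[OF M] _ A] by auto
    obtain B where B: "C \<subseteq> B" "B \<subseteq> ground M" "indep M B" "ground M \<subseteq> closure_in M B"
      using basis_extension[OF M C(2)] C(1) A by (metis subset_refl subset_trans)
    obtain bs where bs: "distinct bs" "set bs = B"
      using B(2) finite_ground[OF M] finite_distinct_list finite_subset by metis
    \<comment> \<open>Any listing of the basis \<open>B\<close> will do here, since \<open>C\<close>
      inherits independence after prefixing.\<close>
    interpret sym_power_flag k M N bs "\<lambda>j. j"
      using bs B by unfold_locales (auto simp: strict_mono_def)
    have "indep N (?p ` C)"
      using indep_subset[OF N prefixed_basis_indep[OF \<tau>], of "?p ` C"] B(1) bs by auto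
    then have "rk N (?p ` C) = card C" by (simp add: indep_def card_image inj_on_def)
    moreover have "?p ` A \<subseteq> closure_in N (?p ` C)"
      using C A letter_closure[OF \<tau>V, of C] by auto
    then have "rk N (?p ` A) = rk N (?p ` C)" using C(1) by (intro rk_eq_if_spanning[OF N]) auto
    moreover have "rk M A = card C"
      using rk_eq_if_spanning[OF M C(1,3)] C(2) by (simp add: indep_def)
    ultimately show ?thesis by simp
  qed
  show "matroid_iso_via (restriction N ({\<tau>} \<cdot> Sym 1 (ground M))) M (last_letter \<tau>)"
    unfolding matroid_iso_via_def singleton_word_prod_letters restriction_def
    using rk by (auto simp: bij_betw_last_letter last_letter_image[simplified] subset_image_iff)
qed

text \<open>For a suitable order and weight, every word meeting \<open>F\<close> is lighter than
  every word avoiding \<open>F\<close>, so the latter stay outside the closure.\<close>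

lemma flat_property: "flat_property k M N"
  unfolding flat_property_def
proof (intro allI impI)
  fix F assume F: "is_flat M F"
  let ?V = "ground M"
  have FV: "F \<subseteq> ?V" and FF: "closure_in M F = F" using F by (auto simp: is_flat_def)
  obtain C where C: "C \<subseteq> F" "indep M C" "F \<subseteq> closure_in M C"
    using basis_extension[OF M indep_empty[OF M] _ FV] by auto
  obtain B where B: "C \<subseteq> B" "B \<subseteq> ?V" "indep M B" "?V \<subseteq> closure_in M B"
    using basis_extension[OF M C(2)] C(1) FV by (metis subset_refl subset_trans)
  have fB: "finite B" using B(2) finite_ground[OF M] finite_subset by auto
  \<comment> \<open>The basis of \<open>F\<close> comes first in the order, so that \<open>F\<close>
    is the flat at level \<open>f\<close> of the flag.\<close>
  obtain cs where cs: "distinct cs" "set cs = C"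
    using B(1) fB finite_distinct_list finite_subset by metis
  obtain ds where ds: "distinct ds" "set ds = B - C"
    using fB finite_distinct_list by (metis finite_Diff)
  define f n where "f = length cs" and "n = length (cs @ ds)"
  \<comment> \<open>The jump at f is so large that a single letter of level at most f makes a word lighter
    than every word all of whose letters have level above f.\<close>
  define g where "g j = (if j \<le> f then j else k * n + j)" for j
  interpret sym_power_flag k M N "cs @ ds" g
  proof unfold_locales
    have "set (cs @ ds) = B" using cs ds B by auto
    then show "indep M (set (cs @ ds))" "?V \<subseteq> closure_in M (set (cs @ ds))" using B by auto
  qed (use cs ds in \<open>auto simp: strict_mono_def g_def\<close>)
  have "closure_in M C = F"
    using C FF closure_in_mono[OF M C(1) FV] by auto
  then have lev_F: "lev v \<le> f \<longleftrightarrow> v \<in> F" if "v \<in> ?V" for v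
    using lev_le_iff[OF that, of f] cs by (simp add: f_def)
  have heavy: "size w * (k * n + f + 1) \<le> wt w" if "set_mset w \<subseteq> ?V - F" for w
    using that
  proof (induction w)
    case (add v w)
    then have "f < lev v" using lev_F[of v] by auto
    then have "k * n + f + 1 \<le> g (lev v)" by (simp add: g_def)
    with add show ?case by simp
  qed (simp add: wt_def)
  have light: "wt w \<le> size w * (k * n + n)" if "set_mset w \<subseteq> ?V" for w
    using that
  proof (induction w)
    case (add v w)
    then have "lev v \<le> n" using lev_le_length[of v] by (simp add: n_def)
    then have "g (lev v) \<le> k * n + n" by (simp add: g_def)
    with add show ?case by simp
  qed (simp add: wt_def)
  let ?S = "{w \<in> Sym k ?V. set_mset w \<inter> F \<noteq> {}}"
  have S: "?S \<subseteq> ground N" by (auto simp: ground_N)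
  have "closure_in N ?S \<subseteq> ?S"
  proof
    fix w assume w: "w \<in> closure_in N ?S"
    then have wV: "w \<in> Sym k ?V" by (simp add: closure_in_def ground_N)
    show "w \<in> ?S"
    proof (rule ccontr)
      assume "w \<notin> ?S"
      then have wF: "set_mset w \<subseteq> ?V - F" using wV by (auto simp: mem_Sym)
      have "u \<in> lighter (wt w)" if uS: "u \<in> ?S" for u
      proof -
        have uV: "u \<in> Sym k ?V" using uS by simp
        obtain x where x: "x \<in># u" "x \<in> F" using uS by blast
        then obtain \<sigma> where u: "u = add_mset x \<sigma>" by (meson multi_member_split)
        then have \<sigma>: "\<sigma> \<in> Sym (k - 1) ?V" using uV Sym_add_mset(2)[of x \<sigma>] by simp
        have "g (lev x) \<le> f" using x lev_F[of x] FV by (auto simp: g_def)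
        moreover have "wt \<sigma> \<le> (k - 1) * (k * n + n)" using light[of \<sigma>] \<sigma> by (simp add: mem_Sym)
        ultimately have "wt u \<le> f + (k - 1) * (k * n + n)" by (simp add: u)
        \<comment> \<open>The \<open>k\<close>-th letter above level \<open>f\<close> contributes an
          extra \<open>k * n\<close>, which covers the at most \<open>(k - 1) * n\<close> by which
          levels vary in the other letters.\<close>
        also have "\<dots> < k * (k * n + f + 1)"
        proof -
          obtain m where "k = Suc m" using k by (cases k) auto
          then show ?thesis by (simp add: algebra_simps)
        qed
        also have "\<dots> \<le> wt w" using heavy[OF wF] wV by (simp add: mem_Sym)
        finally show ?thesis using uV by (simp add: lighter_def)
      qed
      then have "w \<in> closure_in N (lighter (wt w))"
        using w closure_in_mono[OF N _ lighter_subset] by blast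
      \<comment> \<open>A flat contains all loops, so a word avoiding \<open>F\<close> is
        loop-free.\<close>
      moreover have "loops M \<subseteq> F" using loop_in_closure_in[OF M _ FV] FF by auto
      then have "w \<in> Sym k (?V - loops M)" using wF wV by (auto simp: mem_Sym)
      ultimately show False using nonloop_word_not_in_closure_lighter by blast
    qed
  qed
  then show "is_flat N (Sym 1 F \<cdot> Sym (k - 1) ?V)"
    using S subset_closure_in[OF S] unfolding letters_word_prod[OF FV k] is_flat_def by blast
qed

end

section \<open>A symmetric power of too small rank\<close>

text \<open>Cardinality is modular, and the supersets of \<open>C\<close> are closed under
  intersection and enlargement, so union and intersection together lose at least as much as
  \<open>X\<close> and \<open>Y\<close>. Nonemptiness of \<open>C\<close> makes the subtraction
  exact.\<close>

lemma one_circuit_matroid: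
  assumes E: "finite E" and C: "C \<subseteq> E" "C \<noteq> {}"
  shows "is_matroid \<lparr>ground = E, rk = \<lambda>X. if C \<subseteq> X then card X - 1 else card X\<rparr>"
proof -
  let ?r = "\<lambda>X. if C \<subseteq> X then card X - 1 else card X"
  have pos: "card X \<ge> 1" if "C \<subseteq> X" "X \<subseteq> E" for X
    using that C E finite_subset[of X E] by (cases "X = {}") (auto simp: Suc_le_eq card_gt_0_iff)
  have mono: "?r X \<le> ?r Y" if "X \<subseteq> Y" "Y \<subseteq> E" for X Y
  \<comment> \<open>When \<open>C\<close> is completed only in \<open>Y\<close>, the inclusion is
    proper and the extra element offsets the drop by one.\<close>
  proof (cases "C \<subseteq> Y \<and> \<not> C \<subseteq> X")
    case True
    then have "X \<subset> Y" using that by auto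
    then have "card X < card Y" using that E finite_subset[of Y E] by (auto intro: psubset_card_mono)
    then show ?thesis using True by auto
  next
    case False
    have "card X \<le> card Y" using that E finite_subset[of Y E] by (auto intro: card_mono)
    then show ?thesis using False that by auto
  qed
  have submod: "?r (X \<union> Y) + ?r (X \<inter> Y) \<le> ?r X + ?r Y" if XY: "X \<subseteq> E" "Y \<subseteq> E" for X Y
  proof -
    have "card (X \<union> Y) + card (X \<inter> Y) = card X + card Y"
      using XY E finite_subset[of X E] finite_subset[of Y E] card_Un_Int[of X Y] by auto
    moreover have "C \<subseteq> X \<Longrightarrow> card X \<ge> 1" "C \<subseteq> Y \<Longrightarrow> card Y \<ge> 1"
      "C \<subseteq> X \<union> Y \<Longrightarrow> card (X \<union> Y) \<ge> 1" "C \<subseteq> X \<inter> Y \<Longrightarrow> card (X \<inter> Y) \<ge> 1"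
      using XY pos[of X] pos[of Y] pos[of "X \<union> Y"] pos[of "X \<inter> Y"] by blast+
    moreover have "C \<subseteq> X \<Longrightarrow> C \<subseteq> X \<union> Y" "C \<subseteq> Y \<Longrightarrow> C \<subseteq> X \<union> Y"
      "C \<subseteq> X \<inter> Y \<longleftrightarrow> C \<subseteq> X \<and> C \<subseteq> Y" by auto
    ultimately show ?thesis by (auto split: if_splits)
  qed
  show ?thesis
    unfolding is_matroid_def using E mono submod by auto
qed

definition free_matroid :: "'a set \<Rightarrow> 'a matroid" where
  "free_matroid V = \<lparr>ground = V, rk = card\<rparr>"

lemma free_matroid:
  assumes "finite V"
  shows "is_matroid (free_matroid V)"
proof -
  have "finite X" if "X \<subseteq> V" for X using assms that by (rule rev_finite_subset)
  then show ?thesis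
    by (simp add: is_matroid_def free_matroid_def assms card_mono card_Un_Int[symmetric])
qed

definition support_circuit :: "nat \<Rightarrow> nat multiset set" where
  "support_circuit k = {w. size w = k \<and> (set_mset w = {0, 1} \<or> set_mset w = {2, 3})}"

definition deficient_power :: "nat \<Rightarrow> nat multiset matroid" where
  "deficient_power k = \<lparr>ground = Sym k {0..<4},
    rk = \<lambda>X. if support_circuit k \<subseteq> X then card X - 1 else card X\<rparr>"

text \<open>The two words below differ because k is at least 3; for k = 2 the circuit would only
  contain one word of each support and the flat property would fail.\<close>

lemma support_circuit_partner:
  assumes k: "k \<ge> 3" and w: "w \<in> support_circuit k"
  obtains w' where "w' \<in> support_circuit k" "w' \<noteq> w" "set_mset w' = set_mset w"
proof -
  obtain a b where ab: "set_mset w = {a, b}" "a \<noteq> b" "{a, b} = {0, 1} \<or> {a, b} = {2, 3}"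
    using w by (auto simp: support_circuit_def)
  let ?u = "\<lambda>a b. add_mset b (replicate_mset (k - 1) a)"
  \<comment> \<open>The counts are \<open>k - 1\<close> and 1, which differ because \<open>k\<close>
    is at least 3.\<close>
  have "count (?u a b) a \<noteq> count (?u b a) a" using k ab by auto
  then have "?u a b \<noteq> ?u b a" by metis
  moreover have "set_mset (?u a b) = {a, b}" "set_mset (?u b a) = {a, b}"
    using k by (auto simp: set_mset_replicate_mset_subset)
  moreover have "?u a b \<in> support_circuit k" "?u b a \<in> support_circuit k"
    using calculation k ab(3) by (auto simp: support_circuit_def)
  ultimately show ?thesis using that ab by metis
qed

lemma support_circuit_ne:
  assumes "k \<ge> 2" and ab: "(a, b) = (0, 1) \<or> (a, b) = (2, 3)"
  shows "add_mset b (replicate_mset (k - 1) a) \<in> support_circuit k"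
  using assms by (auto simp: support_circuit_def set_mset_replicate_mset_subset)

text \<open>The two supports are disjoint, so any letter misses one of them.\<close>

lemma support_circuit_avoids:
  assumes "k \<ge> 2"
  obtains w where "w \<in> support_circuit k" "a \<notin># w"
proof (cases "a < 2")
  case True
  with that[OF support_circuit_ne[OF assms, of 2 3]] show ?thesis by (auto split: if_splits)
next
  case False
  with that[OF support_circuit_ne[OF assms, of 0 1]] show ?thesis by (auto split: if_splits)
qed

lemma deficient_power:
  assumes k: "k \<ge> 3"
  defines "V \<equiv> {0..<4::nat}"
  defines "M \<equiv> free_matroid V" and "N \<equiv> deficient_power k"
  shows "matroid_on_Sym k M N" "flat_property k M N" "symmetric_q_power k M N"
    "\<not> sp_rank_property k M N"
proof -
  let ?C = "support_circuit k"
  have [simp]: "ground M = V" "\<And>X. rk M X = card X" "ground N = Sym k V"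
    and rkN: "\<And>X. rk N X = (if ?C \<subseteq> X then card X - 1 else card X)"
    by (auto simp: M_def N_def V_def free_matroid_def deficient_power_def)
  have fV: "finite V" by (simp add: V_def)
  have C: "?C \<subseteq> Sym k V" "?C \<noteq> {}"
  proof -
    show "?C \<subseteq> Sym k V"
    proof
      fix w assume "w \<in> ?C"
      then have w: "size w = k" "set_mset w = {0, 1} \<or> set_mset w = {2, 3}"
        by (simp_all add: support_circuit_def)
      from w(2) have "set_mset w \<subseteq> V" by (elim disjE) (simp_all add: V_def)
      with w(1) show "w \<in> Sym k V" by (simp add: mem_Sym)
    qed
    show "?C \<noteq> {}" using support_circuit_ne[of k 0 1] k by force
  qed
  show "matroid_on_Sym k M N"
    using one_circuit_matroid[OF finite_Sym[OF fV] C] free_matroid[OF fV]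
    by (simp add: matroid_on_Sym_def) (simp add: N_def deficient_power_def V_def M_def)
  \<comment> \<open>All words of \<open>X\<close> share a letter of \<open>\<alpha>\<close>, whereas
    some word of the circuit avoids it.\<close>
  have free: "rk N X = card X" if \<alpha>: "\<alpha> \<in> Sym i V" "i \<ge> 1" and X: "X \<subseteq> {\<alpha>} \<cdot> B" for \<alpha> i X B
  proof -
    obtain a where a: "a \<in># \<alpha>" using \<alpha> by (cases \<alpha>) (auto simp: mem_Sym)
    obtain w where "w \<in> ?C" "a \<notin># w" using support_circuit_avoids[of k a] k by auto
    then have "\<not> ?C \<subseteq> X" using a X by (auto simp: word_prod_def)
    then show ?thesis by (simp add: rkN)
  qed
  \<comment> \<open>A free matroid has no loops, so the condition is vacuous.\<close>
  have loops: "loop_condition k M N"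
    by (simp add: loop_condition_def loops_def)
  show "symmetric_q_power k M N"
    unfolding symmetric_q_power_def
  proof (intro conjI allI impI ballI loops)
    fix i \<alpha> \<beta> assume i: "1 \<le> i \<and> i \<le> k - 1"
      and "\<alpha> \<in> Sym i (ground M - loops M)" "\<beta> \<in> Sym i (ground M - loops M)"
    then have \<alpha>: "\<alpha> \<in> Sym i V" and \<beta>: "\<beta> \<in> Sym i V" by (auto simp: mem_Sym)
    let ?S = "\<lambda>\<alpha>. {\<alpha>} \<cdot> Sym (k - i) V"
    have bij: "bij_betw (change_prefix \<alpha> \<beta>) (?S \<alpha>) (?S \<beta>)"
      by (rule bij_betw_byWitness[where f' = "change_prefix \<beta> \<alpha>"])
        (auto simp: word_prod_def change_prefix_def)
    have "rk N (change_prefix \<alpha> \<beta> ` X) = rk N X" if X: "X \<subseteq> ?S \<alpha>" for X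
    proof -
      have "change_prefix \<alpha> \<beta> ` X \<subseteq> ?S \<beta>" using bij X by (auto simp: bij_betw_def)
      moreover have "card (change_prefix \<alpha> \<beta> ` X) = card X"
        using bij X by (meson bij_betw_def card_image inj_on_subset)
      ultimately show ?thesis using free[OF \<alpha> _ X] free[OF \<beta>] i by auto
    qed
    with bij show "matroid_iso_via (restriction N ({\<alpha>} \<cdot> Sym (k - i) (ground M)))
        (restriction N ({\<beta>} \<cdot> Sym (k - i) (ground M))) (change_prefix \<alpha> \<beta>)"
      by (simp add: matroid_iso_via_def restriction_def)
  next
    fix \<alpha> assume "\<alpha> \<in> Sym (k - 1) (ground M - loops M)"
    then have \<alpha>: "\<alpha> \<in> Sym (k - 1) V" by (auto simp: mem_Sym)
    have bij: "bij_betw (last_letter \<alpha>) ({\<alpha>} \<cdot> Sym 1 V) V"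
      unfolding singleton_word_prod_letters by (rule bij_betw_last_letter)
    have "rk M (last_letter \<alpha> ` X) = rk N X" if X: "X \<subseteq> {\<alpha>} \<cdot> Sym 1 V" for X
      using free[OF \<alpha> _ X] k bij X by simp (meson bij_betw_def card_image inj_on_subset)
    with bij show "matroid_iso_via (restriction N ({\<alpha>} \<cdot> Sym 1 (ground M))) M (last_letter \<alpha>)"
      by (simp add: matroid_iso_via_def restriction_def)
  qed
  show "flat_property k M N"
    unfolding flat_property_def
  proof (intro allI impI)
    fix F assume "is_flat M F"
    then have FV: "F \<subseteq> V" by (simp add: is_flat_def)
    let ?S = "{w \<in> Sym k V. set_mset w \<inter> F \<noteq> {}}"
    have "w \<in> ?S" if w: "w \<in> closure_in N ?S" for w
    proof (rule ccontr)
      assume wS: "w \<notin> ?S"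
      have wV: "w \<in> Sym k V" and eq: "rk N (insert w ?S) = rk N ?S"
        using w by (auto simp: closure_in_def)
      have "card (insert w ?S) = card ?S + 1" using wS finite_Sym[OF fV, of k] by simp
      moreover have "card ?S > 0" if "?C \<subseteq> ?S"
        using that C(2) finite_Sym[OF fV, of k] by (auto simp: card_gt_0_iff)
      \<comment> \<open>The rank can stay the same only if \<open>w\<close> is the one word missing
        from the circuit.\<close>
      ultimately have sub: "?C \<subseteq> insert w ?S" and nsub: "\<not> ?C \<subseteq> ?S"
        using eq unfolding rkN by (auto split: if_splits)
      then have "w \<in> ?C" by auto
      then obtain w' where w': "w' \<in> ?C" "w' \<noteq> w" "set_mset w' = set_mset w"
        using support_circuit_partner[OF k] by blast
      \<comment> \<open>The partner word must already meet \<open>F\<close>; having the same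
        support, \<open>w\<close> would meet \<open>F\<close> too.\<close>
      with sub have "w' \<in> ?S" by blast
      with w'(3) wV wS show False by auto
    qed
    moreover have "?S \<subseteq> ground N" by auto
    ultimately have "is_flat N ?S"
      using subset_closure_in[of ?S N] unfolding is_flat_def by blast
    then show "is_flat N (Sym 1 F \<cdot> Sym (k - 1) (ground M))"
      using letters_word_prod[OF FV, of k] k by simp
  qed
  \<comment> \<open>For a free \<open>M\<close> the prescribed rank is the number of all
    \<open>k\<close>-words; positivity makes the loss of one a genuine drop.\<close>
  have "card (Sym k V) > 0" using C finite_Sym[OF fV, of k] by (auto simp: card_gt_0_iff)
  then have "rk N (Sym k V) < card (Sym k V)" using C(1) by (simp add: rkN)
  then show "\<not> sp_rank_property k M N"
    using card_multisets_of_size[OF fV, of k] by (simp add: sp_rank_property_def matroid_rank_def)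
qed

theorem theorem2p3:
  shows "(\<forall>(k::nat) (M :: 'a matroid) (N :: 'a multiset matroid).
            k \<ge> 2 \<and> matroid_on_Sym k M N \<and>
            sp_rank_property k M N \<and> strong_order_multilinearity k M N \<longrightarrow>
            multilinearity k M N \<and> flat_property k M N \<and>
            strong_sp_rank_property k M N \<and> closure_property k M N)
       \<and> (\<forall>k::nat. k \<ge> 3 \<longrightarrow>
            (\<exists>(M :: nat matroid) (N :: nat multiset matroid).
               matroid_on_Sym k M N \<and>
               flat_property k M N \<and> symmetric_q_power k M N \<and>
               \<not> sp_rank_property k M N))"
proof (intro conjI allI impI)
  fix k :: nat and M :: "'a matroid" and N :: "'a multiset matroid"
  assume *: "k \<ge> 2 \<and> matroid_on_Sym k M N \<and>
    sp_rank_property k M N \<and> strong_order_multilinearity k M N"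
  \<comment> \<open>Strong Order Multilinearity enters as letterwise closure; its loop condition is
    supplied separately to Multilinearity.\<close>
  then interpret sym_power k M N
    by unfold_locales (auto intro: strong_order_multilinearity_closure)
  show "multilinearity k M N"
    using * by (intro multilinearity) (auto simp: strong_order_multilinearity_def)
  show "flat_property k M N" "strong_sp_rank_property k M N" "closure_property k M N"
    by (fact flat_property strong_sp_rank_property closure_property)+
qed (use deficient_power in blast)

end
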